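(* Consider a Lipschitz parameterized action Markov decision process with state space $(\mathcal{S},d_{\mathcal{S}})$, environment dynamics $\mathcal{T}(\cdot|s,k,z_k)$ and discount factor $\gamma\in[0,1]$, and let $\hat{\mathcal{T}}(\cdot|s,k,z_k)$ be a learned dynamics. Given an $H$-step sequence $\tau = \{ s_{t_0},k_{t_0},z_{k_{t_0}}, \dots, s_{t_0 + H},k_{t_0 + H},z_{k_{t_0 + H}} \}$ sampled from the environment, the loss $$\mathcal{L}^{\text{ex}}(\tau;f) = \max_{f:\ K(f)\le 1}\ \sum_{t=t_0}^{t_0+H}\gamma^{t-t_0}\Big|\mathbb{E}_{s_{t+1}\sim\mathcal{T}(\cdot|s_t,k_t,z_{k_t})}f(s_{t+1})-\mathbb{E}_{\hat{s}_{t+1}\sim\hat{\mathcal{T}}(\cdot|s_t,k_t,z_{k_t})}f(\hat{s}_{t+1})\Big|$$ satisfies $$\mathcal{L}^{\text{ex}}(\tau;f)\ \le\ \sum_{t=t_0}^{t_0+H}\gamma^{t-t_0}\,W\big(\mathcal{T}(\cdot|s_t,k_t,z_{k_t}),\hat{\mathcal{T}}(\cdot|s_t,k_t,z_{k_t})\big).$$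
   Context: A parameterized action Markov decision process (PAMDP) has a state space $\mathcal{S}$ with metric $d_{\mathcal{S}}$, a hybrid action space $\mathcal{M}=\{(k,z_k): z_k\in\mathcal{Z},\ k\in\{1,\dots,|\mathcal{K}|\}\}$ (discrete action $k$ with continuous parameter $z_k$), a transition kernel $\mathcal{T}(\cdot|s,k,z_k)$ (the environment dynamics), a reward function and a discount factor $\gamma$. The learned dynamics $\hat{\mathcal{T}}(\cdot|s,k,z_k)$ is another transition kernel on the same spaces. $W$ is the (order 1) Wasserstein metric: $W(\mu_1,\mu_2)=\inf_{j}\int\int d_{\mathcal{S}}(x,y)\,j(dx,dy)$, the infimum over all joint distributions $j$ with marginals $\mu_1,\mu_2$. The PAMDP is Lipschitz (a Lipschitz-PAMDP) if there are finite constants $L^{\mathcal{S}}_{\mathcal{T}},L^{\mathcal{K}}_{\mathcal{T}},L^{\mathcal{Z}}_{\mathcal{T}}$ such that for all states $s,s_1,s_2$, discrete actions $k,k_1,k_2$ and parameters $z_k,z_k'$: $W(\mathcal{T}(\cdot|s_1,k,z_k),\mathcal{T}(\cdot|s_2,k,z_k))\le L^{\mathcal{S}}_{\mathcal{T}}d_{\mathcal{S}}(s_1,s_2)$; $W(\mathcal{T}(\cdot|s,k_1,z_k),\mathcal{T}(\cdot|s,k_2,z_k))\le L^{\mathcal{K}}_{\mathcal{T}}d_{\mathcal{K}}(k_1,k_2)$; $W(\mathcal{T}(\cdot|s,k,z_k),\mathcal{T}(\cdot|s,k,z_k'))\le L^{\mathcal{Z}}_{\mathcal{T}}d_{\mathcal{Z}}(z_k,z_k')$,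 where $d_{\mathcal{K}}(k_1,k_2)=1$ for $k_1\ne k_2$ (and $0$ otherwise) and $d_{\mathcal{Z}}$ is the metric on $\mathcal{Z}$. For $f:\mathcal{S}\to\mathbb{R}$, $K(f)=\sup_{x\ne y}|f(x)-f(y)|/d_{\mathcal{S}}(x,y)$ is its Lipschitz constant. In the definition of $\mathcal{L}^{\text{ex}}(\tau;f)$ the variable $f$ is the one maximized over (a single $f$ common to all timesteps), and the maximum is understood as a supremum; the value depends only on $\tau$ (and on $\mathcal{T},\hat{\mathcal{T}},\gamma$). *)

theory Defs
  imports "HOL-Probability.Probability"
begin

(* The state space and the parameter space are arbitrary metric spaces with their Borel
   sigma-algebras; neither separability nor completeness is required.  Product spaces carry the
   Borel sigma-algebra of the product topology.  On second countable spaces this is the product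
   sigma-algebra (borel_prod); in general it is the one for which dist is measurable, so that the
   transport cost below is a genuine integral. *)

definition couplings :: "'s::metric_space measure \<Rightarrow> 's measure \<Rightarrow> ('s \<times> 's) measure set"
  where "couplings \<mu> \<nu> =
    {j. sets j = sets borel \<and> prob_space j \<and> distr j borel fst = \<mu> \<and> distr j borel snd = \<nu>}"

(* Extended-valued: the distance may be infinite if first moments are. *)
definition wasserstein :: "'s::metric_space measure \<Rightarrow> 's measure \<Rightarrow> ennreal"
  where "wasserstein \<mu> \<nu> =
    (INF j\<in>couplings \<mu> \<nu>. \<integral>\<^sup>+ p. ennreal (dist (fst p) (snd p)) \<partial>j)"

definition lip_const :: "('s::metric_space \<Rightarrow> real) \<Rightarrow> ennreal"
  where "lip_const f = (SUP (x, y)\<in>{(x, y). x \<noteq> y}. ennreal (\<bar>f x - f y\<bar> / dist x y))"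

definition dist_K :: "nat \<Rightarrow> nat \<Rightarrow> real"
  where "dist_K k1 k2 = (if k1 = k2 then 0 else 1)"

record ('s, 'z) pamdp =
  num_actions :: nat
  dynamics :: "'s \<Rightarrow> nat \<Rightarrow> 'z \<Rightarrow> 's measure"
  reward :: "'s \<Rightarrow> nat \<Rightarrow> 'z \<Rightarrow> real"
  discount :: real

definition hybrid_actions :: "('s, 'z) pamdp \<Rightarrow> (nat \<times> 'z) set"
  where "hybrid_actions P = {1..num_actions P} \<times> UNIV"

definition transition_kernel ::
    "('s::metric_space, 'z::metric_space) pamdp \<Rightarrow> ('s \<Rightarrow> nat \<Rightarrow> 'z \<Rightarrow> 's measure) \<Rightarrow> bool"
  where "transition_kernel P T \<longleftrightarrow>
    (\<lambda>(s, k, z). T s k z) \<in>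
      restrict_space borel (UNIV \<times> hybrid_actions P) \<rightarrow>\<^sub>M prob_algebra borel"

(* Since wasserstein is extended-valued, the bounds below also assert that the distances occurring
   in them are finite. *)
definition lipschitz_pamdp :: "('s::metric_space, 'z::metric_space) pamdp \<Rightarrow> bool"
  where "lipschitz_pamdp P \<longleftrightarrow>
    transition_kernel P (dynamics P) \<and>
    (\<exists>L\<^sub>S\<ge>0. \<forall>s1 s2. \<forall>(k, z)\<in>hybrid_actions P.
       wasserstein (dynamics P s1 k z) (dynamics P s2 k z) \<le> ennreal (L\<^sub>S * dist s1 s2)) \<and>
    (\<exists>L\<^sub>K\<ge>0. \<forall>s z. \<forall>k1\<in>{1..num_actions P}. \<forall>k2\<in>{1..num_actions P}.
       wasserstein (dynamics P s k1 z) (dynamics P s k2 z) \<le> ennreal (L\<^sub>K * dist_K k1 k2)) \<and>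
    (\<exists>L\<^sub>Z\<ge>0. \<forall>s. \<forall>k\<in>{1..num_actions P}. \<forall>z z'.
       wasserstein (dynamics P s k z) (dynamics P s k z') \<le> ennreal (L\<^sub>Z * dist z z'))"

(* Only the values of s, k, z at the times t0, ..., t0 + H matter.  No moment conditions
   are imposed; the expectations are Bochner integrals, which are 0 for a non-integrable f.  Given a
   coupling of finite cost, a 1-Lipschitz f is integrable under both measures or under neither. *)
definition loss_ex ::
    "('s::metric_space, 'z) pamdp \<Rightarrow> ('s \<Rightarrow> nat \<Rightarrow> 'z \<Rightarrow> 's measure) \<Rightarrow> nat \<Rightarrow> nat \<Rightarrow>
     (nat \<Rightarrow> 's) \<Rightarrow> (nat \<Rightarrow> nat) \<Rightarrow> (nat \<Rightarrow> 'z) \<Rightarrow> ennreal"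
  where "loss_ex P T' t0 H s k z =
    (SUP f\<in>{f. lip_const f \<le> 1}. ennreal (\<Sum>t=t0..t0+H. discount P ^ (t - t0) *
       \<bar>(LINT x|dynamics P (s t) (k t) (z t). f x) - (LINT x|T' (s t) (k t) (z t). f x)\<bar>))"

end

theory Submission
  imports Defs
begin

text \<open>
  This is the easy half of Kantorovich duality, applied at each time step: if \<open>j\<close> couples \<open>\<mu>\<close>
  and \<open>\<nu>\<close>, then \<open>\<integral>f d\<mu> - \<integral>f d\<nu> = \<integral>(f x - f y) dj\<close> is at most the transport cost of \<open>j\<close>
  for every 1-Lipschitz \<open>f\<close>.
\<close>

lemma abs_diff_le_dist_if_lip_const_le_1:
  assumes "lip_const f \<le> 1"
  shows "\<bar>f x - f y\<bar> \<le> dist x y"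
proof (cases "x = y")
  case False
  then have "ennreal (\<bar>f x - f y\<bar> / dist x y) \<le> lip_const f"
    unfolding lip_const_def by (intro SUP_upper2[of "(x, y)"]) auto
  also note assms
  finally have "\<bar>f x - f y\<bar> / dist x y \<le> 1"
    by (simp add: ennreal_le_1)
  then show ?thesis
    using False by (simp add: divide_simps)
qed simp

text \<open>The supremum in the loss ranges over functions with no measurability requirement;
  continuity supplies it.\<close>

lemma borel_measurable_if_lip_const_le_1:
  assumes "lip_const f \<le> 1"
  shows "f \<in> borel_measurable borel"
proof (rule borel_measurable_continuous_onI)
  have "1-lipschitz_on UNIV f"
    by (rule lipschitz_onI)
       (use abs_diff_le_dist_if_lip_const_le_1[OF assms] in \<open>auto simp: dist_real_def\<close>)
  then show "continuous_on UNIV f"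
    by (rule lipschitz_on_continuous_on)
qed

text \<open>No first moments are assumed, so \<open>f\<close> need not be integrable under either
  marginal. Infinite cost makes the bound trivial; finite cost makes the difference of the two
  copies of \<open>f\<close> integrable, which is enough.\<close>

lemma abs_lint_diff_le_coupling_cost:
  fixes f :: "'s::metric_space \<Rightarrow> real"
  assumes f: "lip_const f \<le> 1" and j: "j \<in> couplings \<mu> \<nu>"
  shows "ennreal \<bar>(LINT x|\<mu>. f x) - (LINT x|\<nu>. f x)\<bar> \<le>
    (\<integral>\<^sup>+ p. ennreal (dist (fst p) (snd p)) \<partial>j)"
proof (cases "(\<integral>\<^sup>+ p. ennreal (dist (fst p) (snd p)) \<partial>j) = \<infinity>")
  case False
  have sets_j: "sets j = sets borel" and \<mu>: "\<mu> = distr j borel fst" and \<nu>: "\<nu> = distr j borel snd"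
    using j by (auto simp: couplings_def)
  note f_meas = borel_measurable_if_lip_const_le_1[OF f]
  \<comment> \<open>The coupling carries the Borel sets of the product topology, so continuity gives
    measurability without second countability.\<close>
  have meas: "fst \<in> borel_measurable j" "snd \<in> borel_measurable j"
      "(\<lambda>p. dist (fst p) (snd p)) \<in> borel_measurable j"
    unfolding measurable_cong_sets[OF sets_j refl]
    by (intro borel_measurable_continuous_onI continuous_intros)+
  have f_fst: "(\<lambda>p. f (fst p)) \<in> borel_measurable j"
    and f_snd: "(\<lambda>p. f (snd p)) \<in> borel_measurable j"
    using meas f_meas by (auto intro: measurable_compose)
  have int_dist: "integrable j (\<lambda>p. dist (fst p) (snd p))"
    using meas False by (intro integrableI_nonneg) (auto simp: top.not_eq_extremum)
  \<comment> \<open>Domination by the distance. Hence \<open>f (fst p)\<close> and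
    \<open>f (snd p)\<close> are either both integrable or both not, which drives the case split
    below.\<close>
  have int_diff: "integrable j (\<lambda>p. f (fst p) - f (snd p))"
    by (rule Bochner_Integration.integrable_bound[OF int_dist])
       (use f_fst f_snd abs_diff_le_dist_if_lip_const_le_1[OF f] in auto)
  have lint: "(LINT x|\<mu>. f x) = (LINT p|j. f (fst p))" "(LINT x|\<nu>. f x) = (LINT p|j. f (snd p))"
    unfolding \<mu> \<nu> using meas f_meas by (auto intro: integral_distr)
  have "\<bar>(LINT x|\<mu>. f x) - (LINT x|\<nu>. f x)\<bar> \<le> (LINT p|j. dist (fst p) (snd p))"
  proof (cases "integrable j (\<lambda>p. f (fst p))")
    case True
    then have "integrable j (\<lambda>p. f (snd p))"
      using Bochner_Integration.integrable_diff[OF True int_diff] by simp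
    with True have "(LINT x|\<mu>. f x) - (LINT x|\<nu>. f x) = (LINT p|j. f (fst p) - f (snd p))"
      by (simp add: lint)
    also have "\<bar>\<dots>\<bar> \<le> (LINT p|j. \<bar>f (fst p) - f (snd p)\<bar>)"
      by (rule integral_abs_bound)
    also have "\<dots> \<le> (LINT p|j. dist (fst p) (snd p))"
      using int_diff int_dist abs_diff_le_dist_if_lip_const_le_1[OF f] by (intro integral_mono) auto
    finally show ?thesis .
  next
    case not_int: False
    \<comment> \<open>Both Bochner integrals take the junk value 0.\<close>
    then have "\<not> integrable j (\<lambda>p. f (snd p))"
      using Bochner_Integration.integrable_add[OF int_diff, of "\<lambda>p. f (snd p)"] by auto
    with not_int show ?thesis
      by (simp add: lint not_integrable_integral_eq)
  qed
  then show ?thesis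
    using int_dist by (simp add: nn_integral_eq_integral ennreal_leI)
qed simp

text \<open>The left side does not depend on the coupling, so the bound passes to the infimum, which
  is \<infinity> if there are no couplings.\<close>

lemma abs_lint_diff_le_wasserstein:
  assumes "lip_const f \<le> 1"
  shows "ennreal \<bar>(LINT x|\<mu>. f x) - (LINT x|\<nu>. f x)\<bar> \<le> wasserstein \<mu> \<nu>"
  unfolding wasserstein_def using assms by (intro INF_greatest abs_lint_diff_le_coupling_cost)

theorem theorem3p1:
  fixes P :: "('s::metric_space, 'z::metric_space) pamdp"
    and T' :: "'s \<Rightarrow> nat \<Rightarrow> 'z \<Rightarrow> 's measure"
    and t0 H :: nat
    and s :: "nat \<Rightarrow> 's" and k :: "nat \<Rightarrow> nat" and z :: "nat \<Rightarrow> 'z"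
  assumes "lipschitz_pamdp P"
    and "discount P \<in> {0..1}"
    and "transition_kernel P T'"
    and "\<And>t. t \<in> {t0..t0+H} \<Longrightarrow> (k t, z t) \<in> hybrid_actions P"
  shows "loss_ex P T' t0 H s k z \<le>
    (\<Sum>t=t0..t0+H. ennreal (discount P ^ (t - t0)) *
       wasserstein (dynamics P (s t) (k t) (z t)) (T' (s t) (k t) (z t)))"
  unfolding loss_ex_def
\<comment> \<open>The right side is free of \<open>f\<close>, so bounding each timestep separately
  suffices although one \<open>f\<close> is shared by all of them.\<close>
proof (rule SUP_least)
  fix f :: "'s \<Rightarrow> real"
  assume "f \<in> {f. lip_const f \<le> 1}"
  then have f: "lip_const f \<le> 1"
    by simp
  let ?\<Delta> = "\<lambda>t. \<bar>(LINT x|dynamics P (s t) (k t) (z t). f x) - (LINT x|T' (s t) (k t) (z t). f x)\<bar>"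
  \<comment> \<open>Nonnegative discount powers let \<open>ennreal\<close> commute with the products
    and the sum.\<close>
  have "ennreal (\<Sum>t=t0..t0+H. discount P ^ (t - t0) * ?\<Delta> t) =
      (\<Sum>t=t0..t0+H. ennreal (discount P ^ (t - t0)) * ennreal (?\<Delta> t))"
    using assms(2) by (simp add: ennreal_mult flip: sum_ennreal)
  also have "\<dots> \<le> (\<Sum>t=t0..t0+H. ennreal (discount P ^ (t - t0)) *
      wasserstein (dynamics P (s t) (k t) (z t)) (T' (s t) (k t) (z t)))"
    by (intro sum_mono mult_left_mono abs_lint_diff_le_wasserstein f) simp
  finally show "ennreal (\<Sum>t=t0..t0+H. discount P ^ (t - t0) * ?\<Delta> t) \<le>
      (\<Sum>t=t0..t0+H. ennreal (discount P ^ (t - t0)) *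
        wasserstein (dynamics P (s t) (k t) (z t)) (T' (s t) (k t) (z t)))" .
qed

end
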